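(* Let $R$ be an associative ring (not necessarily unital). For $i=1,2$ let $a_i,b_i,c_i\in R$ and suppose that $a_i$ is annihilator $(b_i,c_i)$-invertible with annihilator $(b_i,c_i)$-inverse $x_i$. Then $a_1a_2$ is annihilator $(b_2,c_1)$-invertible with annihilator $(b_2,c_1)$-inverse equal to $x_2x_1$ if and only if $x_2x_1a_1a_2b_2=b_2$ and $c_1a_1a_2x_2x_1=c_1$.
   Context: For $u\in R$ write ${}^{\circ}u=\{r\in R: ru=0\}$ and $u^{\circ}=\{r\in R: ur=0\}$. For $a,b,c\in R$, an element $x\in R$ is an annihilator $(b,c)$-inverse of $a$ if $xax=x$, $xab=b$, $cax=c$, ${}^{\circ}b\subseteq{}^{\circ}x$, and $c^{\circ}\subseteq x^{\circ}$; such $x$ is unique when it exists, and $a$ is then called annihilator $(b,c)$-invertible. *)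

theory Defs
  imports Main
begin

text \<open>The type class \<^class>\<open>ring\<close> of the library is the class of associative rings
  that are not required to be unital or commutative.\<close>

definition left_ann :: "'a::ring \<Rightarrow> 'a set" where
  "left_ann u = {r. r * u = 0}"

definition right_ann :: "'a::ring \<Rightarrow> 'a set" where
  "right_ann u = {r. u * r = 0}"

definition is_ann_inverse :: "'a::ring \<Rightarrow> 'a \<Rightarrow> 'a \<Rightarrow> 'a \<Rightarrow> bool" where
  "is_ann_inverse b c a x \<longleftrightarrow>
     x * a * x = x \<and> x * a * b = b \<and> c * a * x = c \<and>
     left_ann b \<subseteq> left_ann x \<and> right_ann c \<subseteq> right_ann x"

definition ann_invertible :: "'a::ring \<Rightarrow> 'a \<Rightarrow> 'a \<Rightarrow> bool" where
  "ann_invertible b c a \<longleftrightarrow> (\<exists>x. is_ann_inverse b c a x)"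

text \<open>By uniqueness, the predicate \<^const>\<open>is_ann_inverse\<close> expresses that \<open>x\<close> is equal to
  the annihilator \<open>(b, c)\<close>-inverse of \<open>a\<close>.\<close>

lemma is_ann_inverse_unique:
  fixes a b c x y :: "'a::ring"
  assumes x: "is_ann_inverse b c a x" and y: "is_ann_inverse b c a y"
  shows "x = y"
proof -
  have "x * a - y * a \<in> left_ann b"
    using x y by (simp add: is_ann_inverse_def left_ann_def left_diff_distrib)
  then have "x * a - y * a \<in> left_ann x"
    using x by (auto simp: is_ann_inverse_def)
  then have 1: "x = y * a * x"
    using x by (simp add: is_ann_inverse_def left_ann_def left_diff_distrib)
  have "a * x - a * y \<in> right_ann c"
    using x y by (simp add: is_ann_inverse_def right_ann_def right_diff_distrib
        flip: mult.assoc)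
  then have "a * x - a * y \<in> right_ann y"
    using y by (auto simp: is_ann_inverse_def)
  then have "y * a * x = y"
    using y by (simp add: is_ann_inverse_def right_ann_def right_diff_distrib
        flip: mult.assoc)
  with 1 show ?thesis by simp
qed

end

theory Submission
  imports Defs
begin

text \<open>
  Put \<open>x = x2 * x1\<close> and \<open>a = a1 * a2\<close>. Up to associativity, the two identities on the right
  of the equivalence are the conditions \<open>x * a * b2 = b2\<close> and \<open>c1 * a * x = c1\<close> of an
  annihilator inverse, so only sufficiency has content. The annihilator conditions
  pass from the factors to the product: whatever kills \<open>b2\<close> from the left kills \<open>x2\<close>, the
  left factor of \<open>x\<close>, and whatever \<open>c1\<close> kills on its right is killed by \<open>x1\<close>, the right
  factor of \<open>x\<close>.

  What remains is \<open>x * a * x = x\<close>. By \<open>left_fix_transfer\<close>, an element that fixes \<open>b2\<close> under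
  left multiplication also fixes \<open>x2\<close>; since \<open>x * a\<close> fixes \<open>b2\<close>, it fixes \<open>x2\<close>, and
  therefore \<open>x2 * x1\<close>.
\<close>

text \<open>
  In a unital ring this would be the inclusion of left annihilators applied to \<open>u - 1\<close>. Here
  \<open>x * a\<close> takes the place of the unit: it fixes both \<open>b\<close> and \<open>x\<close>, so the inclusion is applied
  to \<open>u - x * a\<close>.
\<close>

lemma left_fix_transfer:
  fixes a b c u x :: "'a::ring"
  assumes x: "is_ann_inverse b c a x" and u: "u * b = b"
  shows "u * x = x"
proof -
  have "u - x * a \<in> left_ann b"
    using x u by (simp add: is_ann_inverse_def left_ann_def left_diff_distrib)
  then have "u - x * a \<in> left_ann x"
    using x by (auto simp: is_ann_inverse_def)
  then show ?thesis
    using x by (simp add: is_ann_inverse_def left_ann_def left_diff_distrib)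
qed

lemma left_ann_mult: "left_ann u \<subseteq> left_ann (u * v)"
  by (auto simp: left_ann_def simp flip: mult.assoc)

lemma right_ann_mult: "right_ann v \<subseteq> right_ann (u * v)"
  by (auto simp: right_ann_def mult.assoc)

theorem theorem4p4:
  fixes a1 a2 b1 b2 c1 c2 x1 x2 :: "'a::ring"
  assumes "ann_invertible b1 c1 a1" and "is_ann_inverse b1 c1 a1 x1"
    and "ann_invertible b2 c2 a2" and "is_ann_inverse b2 c2 a2 x2"
  shows "(ann_invertible b2 c1 (a1 * a2) \<and> is_ann_inverse b2 c1 (a1 * a2) (x2 * x1))
    \<longleftrightarrow> (x2 * x1 * a1 * a2 * b2 = b2 \<and> c1 * a1 * a2 * x2 * x1 = c1)"
proof
  assume "ann_invertible b2 c1 (a1 * a2) \<and> is_ann_inverse b2 c1 (a1 * a2) (x2 * x1)"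
  then show "x2 * x1 * a1 * a2 * b2 = b2 \<and> c1 * a1 * a2 * x2 * x1 = c1"
    by (simp add: is_ann_inverse_def mult.assoc)
next
  assume ids: "x2 * x1 * a1 * a2 * b2 = b2 \<and> c1 * a1 * a2 * x2 * x1 = c1"
  then have "x2 * x1 * a1 * a2 * x2 = x2"
    using left_fix_transfer assms(4) by blast
  then have "x2 * x1 * (a1 * a2) * (x2 * x1) = x2 * x1"
    by (simp flip: mult.assoc)
  moreover have "left_ann b2 \<subseteq> left_ann (x2 * x1)"
    using assms(4) left_ann_mult[of x2 x1] by (auto simp: is_ann_inverse_def)
  moreover have "right_ann c1 \<subseteq> right_ann (x2 * x1)"
    using assms(2) right_ann_mult[of x1 x2] by (auto simp: is_ann_inverse_def)
  ultimately have "is_ann_inverse b2 c1 (a1 * a2) (x2 * x1)"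
    using ids by (simp add: is_ann_inverse_def flip: mult.assoc)
  then show "ann_invertible b2 c1 (a1 * a2) \<and> is_ann_inverse b2 c1 (a1 * a2) (x2 * x1)"
    by (auto simp: ann_invertible_def)
qed

end
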